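(* Let $\mu$ be a Borel probability measure on $\mathbb{C}$ that is symmetric with respect to the real line (i.e. $\mu(E)=\mu(\{\overline{z}:z\in E\})$ for every Borel set $E\subset\mathbb{C}$), and suppose that its potential $u_\mu$ satisfies $$u_\mu(z)\le u_\mu(|z|)\quad\text{for all } z\in\mathbb{C}.$$ Let $$m(t)=\mu\{z\in\mathbb{C}^*: 0\le|\mathrm{Arg}\, z|\le t\},\qquad 0\le t\le\pi.$$ Then $$\frac{1}{a}\int_0^a m(t)\,dt\le\frac{a}{2\pi}\quad\text{for every } a \text{ with } 0<a\le\pi.$$
   Context: $\mathbb{C}^*=\mathbb{C}\setminus\{0\}$, and $\mathrm{Arg}\, z\in(-\pi,\pi]$ is the principal argument of $z\in\mathbb{C}^*$. For a finite (positive Borel) measure $\mu$ on $\mathbb{C}$, its potential is the function $u_\mu:\mathbb{C}\to[-\infty,\infty)$, $$u_\mu(z)=\int_{|\zeta|\le1}\log|z-\zeta|\,d\mu(\zeta)+\int_{|\zeta|>1}\log\left|1-\frac{z}{\zeta}\right|d\mu(\zeta).$$ *)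

theory Defs
  imports "HOL-Probability.Probability"
begin

(* The library has ln 0 = 0; potentials need log 0 = -\<infinity>.  Used only for x \<ge> 0. *)
definition log_ext :: "real \<Rightarrow> ereal" where
  "log_ext x = (if x = 0 then -\<infinity> else ereal (ln x))"

(* Integral of an extended real function over A, as the integral of the positive part minus that
   of the negative part (e2ennreal truncates negative values to 0).  It is the usual
   integral as soon as one of the two parts is finite.  In the potential of a finite measure
   the positive parts are always finite, the integrands being at most ln (1 + cmod z). *)
definition ext_integral :: "'a measure \<Rightarrow> 'a set \<Rightarrow> ('a \<Rightarrow> ereal) \<Rightarrow> ereal" where
  "ext_integral M A f =
     enn2ereal (\<integral>\<^sup>+x\<in>A. e2ennreal (f x) \<partial>M) - enn2ereal (\<integral>\<^sup>+x\<in>A. e2ennreal (- f x) \<partial>M)"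

definition potential :: "complex measure \<Rightarrow> complex \<Rightarrow> ereal" where
  "potential M z =
     ext_integral M {w. cmod w \<le> 1} (\<lambda>w. log_ext (cmod (z - w))) +
     ext_integral M {w. cmod w > 1} (\<lambda>w. log_ext (cmod (1 - z / w)))"

definition conj_symmetric :: "complex measure \<Rightarrow> bool" where
  "conj_symmetric M \<longleftrightarrow> (\<forall>E\<in>sets borel. emeasure M E = emeasure M (cnj ` E))"

definition sector_mass :: "complex measure \<Rightarrow> real \<Rightarrow> real" where
  "sector_mass M t = measure M {z. z \<noteq> 0 \<and> 0 \<le> \<bar>Arg z\<bar> \<and> \<bar>Arg z\<bar> \<le> t}"

end

theory Submission
  imports Defs
begin

text \<open>
  For \<open>w = s e\<^sup>i\<^sup>\<theta>\<close> the difference of the logarithmic kernels of \<open>w\<close> at \<open>r e\<^sup>i\<^sup>\<phi>\<close> and of \<open>s\<close> at \<open>r\<close>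
  is \<open>ln |1 - x e\<^sup>i\<^sup>\<alpha>| - ln |1 - x| \<ge> 0\<close> with \<open>x = r / s\<close>, where \<open>\<alpha> \<in> [0, \<pi>]\<close> is the angle between the two
  rays. Its integral against the scale invariant measure \<open>dr / r\<close> is \<open>\<pi> \<alpha> - \<alpha>\<^sup>2 / 2\<close>. Integrating
  \<open>u(r e\<^sup>i\<^sup>\<phi>) \<le> u(r)\<close> against \<open>dr / r\<close> for \<open>\<phi> = a\<close> and \<open>\<phi> = -a\<close>, and using Tonelli, leads to
  \<open>\<integral> (2 \<pi> max(0, a - |Arg w|) - a\<^sup>2) d\<mu> \<le> 0\<close> over \<open>w \<noteq> 0\<close>; and
  \<open>\<integral> max(0, a - |Arg w|) d\<mu>\<close> is the integral of \<open>m\<close> over \<open>[0, a]\<close>.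
\<close>

section \<open>The logarithmic gap and its integral against dr / r\<close>

text \<open>Here \<open>c\<close> is the cosine of the angle \<open>t\<close>: for \<open>x \<noteq> 1\<close> this is \<open>ln |1 - x e\<^sup>i\<^sup>t| - ln |1 - x|\<close>.\<close>

definition log_gap :: "real \<Rightarrow> real \<Rightarrow> real" where
  "log_gap x c = ln (1 - 2 * x * c + x\<^sup>2) / 2 - ln \<bar>1 - x\<bar>"

text \<open>The value of the integral of \<open>log_gap x c / x\<close> over x > 0; as a function of
  the cosine it composes directly with \<open>dir_cos\<close>.\<close>

definition gap_weight :: "real \<Rightarrow> real" where
  "gap_weight c = pi * arccos c - (arccos c)\<^sup>2 / 2"

lemma gap_weight_bounds:
  assumes "-1 \<le> c" "c \<le> 1"
  shows "0 \<le> gap_weight c" "gap_weight c \<le> pi\<^sup>2 / 2"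
proof -
  have A: "0 \<le> arccos c" "arccos c \<le> pi"
    using assms by (auto intro: arccos_lbound arccos_ubound)
  have "arccos c * arccos c \<le> pi * arccos c" "0 \<le> pi * arccos c"
    using A by (auto intro: mult_right_mono)
  then show "0 \<le> gap_weight c"
    unfolding gap_weight_def power2_eq_square by linarith
  have "0 \<le> (pi - arccos c)\<^sup>2" by simp
  then show "gap_weight c \<le> pi\<^sup>2 / 2"
    unfolding gap_weight_def by (simp add: power2_eq_square algebra_simps)
qed

lemma quadratic_ge:
  fixes x c :: real
  assumes "0 \<le> x" "c \<le> 1"
  shows "(1 - x)\<^sup>2 \<le> 1 - 2 * x * c + x\<^sup>2"
  using mult_left_mono[OF assms(2,1)] by (simp add: power2_eq_square algebra_simps)

text \<open>The quadratic under the logarithm is at least (1 - x)^2. At x = 1 the convention ln 0 =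
  0 would replace an infinite gap by a possibly negative number.\<close>

lemma log_gap_nonneg:
  assumes "0 \<le> x" "x \<noteq> 1" "c \<le> 1"
  shows "0 \<le> log_gap x c"
proof -
  have "ln ((1 - x)\<^sup>2) \<le> ln (1 - 2 * x * c + x\<^sup>2)"
    using quadratic_ge[of x c] assms by (intro ln_mono) (auto simp: zero_less_power2)
  moreover have "ln ((1 - x)\<^sup>2) = 2 * ln \<bar>1 - x\<bar>"
    using assms by (subst power2_abs[symmetric], subst ln_realpow) auto
  ultimately show ?thesis by (simp add: log_gap_def)
qed

text \<open>Writing the gap as the integral of its angular derivative makes the radial integral elementary
  after an application of Tonelli.\<close>

lemma log_gap_div_eq_nn_integral:
  assumes "0 < x" "x \<noteq> 1" "0 \<le> \<alpha>" "\<alpha> \<le> pi"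
  shows "ennreal (log_gap x (cos \<alpha>) / x) =
    (\<integral>\<^sup>+t. ennreal (sin t / (1 - 2 * x * cos t + x\<^sup>2)) * indicator {0..\<alpha>} t \<partial>lborel)"
proof -
  have pos: "0 < 1 - 2 * x * cos t + x\<^sup>2" for t
    using quadratic_ge[of x "cos t"] assms by (smt (verit) cos_le_one zero_less_power2)
  define F where "F t = ln (1 - 2 * x * cos t + x\<^sup>2) / (2 * x)" for t
  have "(\<integral>\<^sup>+t. ennreal (sin t / (1 - 2 * x * cos t + x\<^sup>2)) * indicator {0..\<alpha>} t \<partial>lborel)
      = ennreal (F \<alpha> - F 0)"
  proof (rule nn_integral_FTC_Icc)
    show "DERIV F t :> sin t / (1 - 2 * x * cos t + x\<^sup>2)" for t
    proof -
      have "DERIV F t :> (2 * x * sin t / (1 - 2 * x * cos t + x\<^sup>2)) / (2 * x)"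
        unfolding F_def using pos[of t] assms by (auto intro!: derivative_eq_intros)
      then show ?thesis using assms by simp
    qed
    show "0 \<le> sin t / (1 - 2 * x * cos t + x\<^sup>2)" if "t \<in> {0..\<alpha>}" for t
      using that assms pos[of t] by (auto intro!: divide_nonneg_pos sin_ge_zero)
  qed (use assms in auto)
  moreover have "F \<alpha> - F 0 = log_gap x (cos \<alpha>) / x"
  proof -
    have "1 - 2 * x * cos 0 + x\<^sup>2 = \<bar>1 - x\<bar>\<^sup>2"
      by (simp add: power2_eq_square algebra_simps)
    then have "ln (1 - 2 * x * cos 0 + x\<^sup>2) = 2 * ln \<bar>1 - x\<bar>"
      using assms by (simp only: ln_realpow)
    then show ?thesis
      using assms unfolding F_def log_gap_def by (simp add: field_simps)
  qed
  ultimately show ?thesis by simp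
qed

text \<open>Completing the square turns the denominator into (x - cos t)^2 + (sin t)^2, which has an
  arctangent primitive. The value jumps at t = 0, where the integrand is identically 0 but pi - t is
  pi.\<close>

lemma nn_integral_sin_div_quadratic:
  assumes "0 < t" "t \<le> pi"
  shows "(\<integral>\<^sup>+x. ennreal (sin t / (1 - 2 * x * cos t + x\<^sup>2)) * indicator {0..} x \<partial>lborel)
    = ennreal (pi - t)"
proof (cases "t = pi")
  case False
  then have s: "0 < sin t" using assms by (intro sin_gt_zero) auto
  have sq: "1 - 2 * x * cos t + x\<^sup>2 = (sin t)\<^sup>2 + (x - cos t)\<^sup>2" for x
    using sin_cos_squared_add[of t] by (simp add: power2_eq_square algebra_simps)
  define F where "F x = arctan ((x - cos t) / sin t)" for x
  have "(\<integral>\<^sup>+x. ennreal (sin t / (1 - 2 * x * cos t + x\<^sup>2)) * indicator {0..} x \<partial>lborel)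
      = ennreal (pi / 2 - F 0)"
  proof (rule nn_integral_FTC_atLeast)
    show "DERIV F x :> sin t / (1 - 2 * x * cos t + x\<^sup>2)" for x
    proof -
      have "0 < (sin t)\<^sup>2 + (x - cos t)\<^sup>2" using s by (simp add: add_pos_nonneg)
      then show ?thesis
        unfolding F_def sq using s
        by (auto intro!: derivative_eq_intros simp: field_simps power2_eq_square)
    qed
    show "0 \<le> sin t / (1 - 2 * x * cos t + x\<^sup>2)" for x
      unfolding sq using s by auto
    have "filterlim (\<lambda>x. (x - cos t) / sin t) at_top at_top"
      using s unfolding divide_inverse
      by (intro filterlim_at_top_mult_tendsto_pos[OF tendsto_const]
          filterlim_tendsto_add_at_top[OF tendsto_const filterlim_ident, of "- cos t", simplified])
        auto
    then show "(F \<longlongrightarrow> pi / 2) at_top"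
      unfolding F_def by (rule filterlim_compose[OF tendsto_arctan_at_top])
  qed simp
  moreover have "F 0 = t - pi / 2"
  proof -
    \<comment> \<open>Since 0 < t < pi, the angle t - pi / 2 lies in the open interval on which
      arctan inverts tan.\<close>
    have "(0 - cos t) / sin t = tan (t - pi / 2)"
      by (simp add: tan_def sin_diff cos_diff)
    then show ?thesis
      unfolding F_def using assms False by (simp add: arctan_tan)
  qed
  ultimately show ?thesis by simp
qed simp

lemma nn_integral_log_gap_cos:
  assumes "0 \<le> \<alpha>" "\<alpha> \<le> pi"
  shows "(\<integral>\<^sup>+x\<in>{0<..}. ennreal (log_gap x (cos \<alpha>) / x) \<partial>lborel) = ennreal (pi * \<alpha> - \<alpha>\<^sup>2 / 2)"
proof -
  have "(\<integral>\<^sup>+x\<in>{0<..}. ennreal (log_gap x (cos \<alpha>) / x) \<partial>lborel)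
      = (\<integral>\<^sup>+x. (\<integral>\<^sup>+t. ennreal (sin t / (1 - 2 * x * cos t + x\<^sup>2)) * indicator {0..\<alpha>} t
           * indicator {0..} x \<partial>lborel) \<partial>lborel)"
  proof (rule nn_integral_cong_AE)
    show "AE x in lborel. ennreal (log_gap x (cos \<alpha>) / x) * indicator {0<..} x
        = (\<integral>\<^sup>+t. ennreal (sin t / (1 - 2 * x * cos t + x\<^sup>2)) * indicator {0..\<alpha>} t
           * indicator {0..} x \<partial>lborel)"
      \<comment> \<open>At x = 0 the indicators of \<open>{0<..}\<close> and \<open>{0..}\<close>
        differ; x = 1 is the logarithmic singularity.\<close>
      using AE_lborel_singleton[of 0] AE_lborel_singleton[of 1]
    proof eventually_elim
      case (elim x)
      then show ?case
        using assms by (subst nn_integral_multc)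
          (auto simp: log_gap_div_eq_nn_integral split: split_indicator)
    qed
  qed
  also have "\<dots> = (\<integral>\<^sup>+t. (\<integral>\<^sup>+x. ennreal (sin t / (1 - 2 * x * cos t + x\<^sup>2)) * indicator {0..\<alpha>} t
           * indicator {0..} x \<partial>lborel) \<partial>lborel)"
    by (rule lborel_pair.Fubini'[symmetric]) measurable
  also have "\<dots> = (\<integral>\<^sup>+t. ennreal (pi - t) * indicator {0..\<alpha>} t \<partial>lborel)"
  proof (rule nn_integral_cong_AE)
    show "AE t in lborel. (\<integral>\<^sup>+x. ennreal (sin t / (1 - 2 * x * cos t + x\<^sup>2)) * indicator {0..\<alpha>} t
           * indicator {0..} x \<partial>lborel) = ennreal (pi - t) * indicator {0..\<alpha>} t"
      \<comment> \<open>Discards the one angle in the range at which the inner integral is not pi -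
        t.\<close>
      using AE_lborel_singleton[of 0]
    proof eventually_elim
      case (elim t)
      then show ?case
        using assms nn_integral_sin_div_quadratic[of t] by (auto split: split_indicator)
    qed
  qed
  also have "\<dots> = ennreal ((pi * \<alpha> - \<alpha>\<^sup>2 / 2) - (pi * 0 - 0\<^sup>2 / 2))"
    using assms by (intro nn_integral_FTC_Icc) (auto intro!: derivative_eq_intros)
  finally show ?thesis by simp
qed

text \<open>Scale invariance of dr / r: the substitution r = s * x removes the modulus s.\<close>

lemma nn_integral_log_gap:
  assumes "-1 \<le> c" "c \<le> 1" "0 < s"
  shows "(\<integral>\<^sup>+r\<in>{0<..}. ennreal (log_gap (r / s) c / r) \<partial>lborel) = ennreal (gap_weight c)"
proof -
  have [measurable]: "(\<lambda>x. log_gap x c) \<in> borel_measurable borel"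
    unfolding log_gap_def by measurable
  have "(\<integral>\<^sup>+r\<in>{0<..}. ennreal (log_gap (r / s) c / r) \<partial>lborel)
      = ennreal \<bar>s\<bar> * (\<integral>\<^sup>+x. ennreal (log_gap ((0 + s * x) / s) c / (0 + s * x))
          * indicator {0<..} (0 + s * x) \<partial>lborel)"
    using assms by (intro nn_integral_real_affine) auto
  also have "\<dots> = (\<integral>\<^sup>+x. ennreal \<bar>s\<bar> * (ennreal (log_gap ((0 + s * x) / s) c / (0 + s * x))
          * indicator {0<..} (0 + s * x)) \<partial>lborel)"
    by (rule nn_integral_cmult[symmetric]) measurable
  also have "\<dots> = (\<integral>\<^sup>+x\<in>{0<..}. ennreal (log_gap x (cos (arccos c)) / x) \<partial>lborel)"
    using assms by (intro nn_integral_cong)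
      (auto simp: ennreal_mult'[symmetric] zero_less_mult_iff split: split_indicator)
  also have "\<dots> = ennreal (gap_weight c)"
    unfolding gap_weight_def using assms
    by (intro nn_integral_log_gap_cos) (auto intro: arccos_lbound arccos_ubound)
  finally show ?thesis .
qed

text \<open>For |y| <= 2 * pi the weight of cos y is pi * |y| - y^2 / 2, because this expression is
  unchanged when |y| is replaced by 2 * pi - |y|. For the angles a - A and - a - A the quadratic
  terms add up to a^2 + A^2, and |a - A| + |a + A| = 2 * max a |A| produces the excess of a over
  |A|.\<close>

lemma gap_weight_symmetrized:
  assumes a: "0 < a" "a \<le> pi" and A: "- pi < A" "A \<le> pi"
  shows "gap_weight (cos (a - A)) + gap_weight (cos (- a - A)) + a\<^sup>2
    = 2 * gap_weight (cos (0 - A)) + 2 * pi * max 0 (a - \<bar>A\<bar>)"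
proof -
  have *: "arccos (cos y) = (if \<bar>y\<bar> \<le> pi then \<bar>y\<bar> else 2 * pi - \<bar>y\<bar>)" if "\<bar>y\<bar> \<le> 2 * pi" for y :: real
  proof (cases "\<bar>y\<bar> \<le> pi")
    case False
    have "cos y = cos (2 * pi - \<bar>y\<bar>)" by (simp add: cos_diff abs_if)
    moreover have "arccos (cos (2 * pi - \<bar>y\<bar>)) = 2 * pi - \<bar>y\<bar>"
      using False that by (intro arccos_cos) auto
    ultimately show ?thesis using False by simp
  qed (simp add: arccos_cos_eq_abs)
  have **: "gap_weight (cos y) = pi * \<bar>y\<bar> - y\<^sup>2 / 2" if "\<bar>y\<bar> \<le> 2 * pi" for y
    unfolding gap_weight_def *[OF that]
    by (auto simp: power2_eq_square field_simps abs_if)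
  have e: "gap_weight (cos (a - A)) = pi * \<bar>a - A\<bar> - (a - A)\<^sup>2 / 2"
    "gap_weight (cos (- a - A)) = pi * \<bar>- a - A\<bar> - (- a - A)\<^sup>2 / 2"
    "gap_weight (cos (0 - A)) = pi * \<bar>0 - A\<bar> - (0 - A)\<^sup>2 / 2"
    using a A by (intro **; linarith)+
  have "\<bar>a - A\<bar> + \<bar>- a - A\<bar> = 2 * \<bar>A\<bar> + 2 * max 0 (a - \<bar>A\<bar>)"
    using a by (auto simp: abs_if max_def)
  then have "pi * (\<bar>a - A\<bar> + \<bar>- a - A\<bar>) = pi * (2 * \<bar>A\<bar> + 2 * max 0 (a - \<bar>A\<bar>))"
    by simp
  then show ?thesis
    unfolding e by (simp add: power2_eq_square field_simps del: max_less_iff_conj)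
qed

section \<open>Splitting the potential kernel into a radial part and a gap\<close>

text \<open>The cosine of the angle between \<open>w\<close> and the ray of argument \<open>\<phi>\<close> (junk value 0 at \<open>w = 0\<close>).
  Working with cosines avoids measurability questions for \<open>Arg\<close>.\<close>

definition dir_cos :: "real \<Rightarrow> complex \<Rightarrow> real" where
  "dir_cos \<phi> w = Re (w * cis (- \<phi>)) / cmod w"

text \<open>The real-valued integrand of the potential. At w = z it is ln 0 = 0 instead of minus
  infinity, so z must carry no mass for it to represent the potential.\<close>

definition pot_kernel :: "complex \<Rightarrow> complex \<Rightarrow> real" where
  "pot_kernel z w = (if cmod w \<le> 1 then ln (cmod (z - w)) else ln (cmod (1 - z / w)))"

text \<open>The cosine is a parameter so that the constant -1, the opposite direction, fits as well.
  The value at w = 0 is the true gap, since ln |z| is radial.\<close>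

definition ray_gap :: "(complex \<Rightarrow> real) \<Rightarrow> real \<Rightarrow> complex \<Rightarrow> real" where
  "ray_gap \<kappa> r w = (if w = 0 then 0 else log_gap (r / cmod w) (\<kappa> w))"

lemma dir_cos_bounds: "-1 \<le> dir_cos \<phi> w \<and> dir_cos \<phi> w \<le> 1"
proof -
  have "\<bar>Re (w * cis (- \<phi>))\<bar> \<le> cmod w"
    using abs_Re_le_cmod[of "w * cis (- \<phi>)"] by (simp add: norm_mult)
  then have "\<bar>dir_cos \<phi> w\<bar> \<le> 1"
    unfolding dir_cos_def by (cases "w = 0") (auto simp: abs_divide)
  then show ?thesis by auto
qed

lemma dir_cos_eq: "w \<noteq> 0 \<Longrightarrow> dir_cos \<phi> w = cos (\<phi> - Arg w)"
proof -
  assume "w \<noteq> 0"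
  then have "Re (w * cis (- \<phi>)) = cmod w * cos (Arg w - \<phi>)"
    by (subst rcis_cmod_Arg[symmetric, of w]) (simp add: rcis_def cis_mult mult.assoc del: rcis_cmod_Arg)
  then show ?thesis
    using \<open>w \<noteq> 0\<close> by (simp add: dir_cos_def cos_diff mult.commute)
qed

lemma measurable_dir_cos [measurable]: "dir_cos \<phi> \<in> borel_measurable borel"
  unfolding dir_cos_def by measurable

lemma cmod_one_minus_rcis: "(cmod (1 - rcis x t))\<^sup>2 = 1 - 2 * x * cos t + x\<^sup>2"
proof -
  have "(cmod (1 - rcis x t))\<^sup>2 = (1 - x * cos t)\<^sup>2 + (x * sin t)\<^sup>2"
    by (simp add: cmod_power2)
  also have "\<dots> = 1 - 2 * x * cos t + x\<^sup>2 * ((sin t)\<^sup>2 + (cos t)\<^sup>2)"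
    by (simp add: power2_eq_square algebra_simps del: sin_cos_squared_add sin_cos_squared_add2 sin_cos_squared_add3)
  finally show ?thesis by simp
qed

lemma ln_cmod_one_minus_divide:
  assumes "0 < r" "r \<noteq> cmod w" "w \<noteq> 0"
  shows "ln (cmod (1 - rcis r \<phi> / w)) = ln \<bar>1 - r / cmod w\<bar> + log_gap (r / cmod w) (dir_cos \<phi> w)"
proof -
  define x where "x = r / cmod w"
  have x: "0 < x" "x \<noteq> 1" using assms by (auto simp: x_def field_simps)
  have "rcis r \<phi> / w = rcis x (\<phi> - Arg w)"
    unfolding x_def by (subst (1) rcis_cmod_Arg[symmetric, of w]) (simp only: rcis_divide)
  then have sq: "(cmod (1 - rcis r \<phi> / w))\<^sup>2 = 1 - 2 * x * dir_cos \<phi> w + x\<^sup>2"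
    by (simp add: cmod_one_minus_rcis dir_cos_eq assms)
  have "0 < (cmod (1 - rcis r \<phi> / w))\<^sup>2"
    using quadratic_ge[of x "dir_cos \<phi> w"] dir_cos_bounds[of \<phi> w] x unfolding sq
    by (smt (verit) zero_less_power2)
  then have "0 < cmod (1 - rcis r \<phi> / w)" by simp
  then have "ln ((cmod (1 - rcis r \<phi> / w))\<^sup>2) = 2 * ln (cmod (1 - rcis r \<phi> / w))"
    by (simp only: ln_realpow)
  then show ?thesis
    unfolding sq log_gap_def x_def by simp
qed

lemma ln_cmod_diff:
  fixes z w :: complex
  assumes "w \<noteq> 0" "z \<noteq> w"
  shows "ln (cmod (z - w)) = ln (cmod w) + ln (cmod (1 - z / w))"
proof -
  have "cmod (z - w) = cmod w * cmod (1 - z / w)"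
    using assms by (simp add: norm_mult[symmetric] algebra_simps norm_minus_commute)
  then show ?thesis using assms by (simp add: ln_mult)
qed

text \<open>Both kernels are in the same branch, which depends on |w| alone, and for 0 < |w| <= 1
  the common term ln |w| cancels. What remains is the gap; r \<noteq> |w| keeps every logarithm
  finite.\<close>

lemma pot_kernel_rcis:
  assumes "0 < r" "r \<noteq> cmod w"
  shows "pot_kernel (rcis r \<phi>) w
    = pot_kernel (of_real r) (of_real (cmod w)) + ray_gap (dir_cos \<phi>) r w"
proof (cases "w = 0")
  case True
  then show ?thesis using assms by (simp add: pot_kernel_def ray_gap_def)
next
  case False
  have "cmod (rcis r \<phi>) \<noteq> cmod w" using assms by simp
  then have "rcis r \<phi> \<noteq> w" by blast
  have ne: "complex_of_real r \<noteq> of_real (cmod w)" using assms by simp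
  have "cmod (1 - complex_of_real r / complex_of_real (cmod w)) = \<bar>1 - r / cmod w\<bar>"
    by (metis norm_of_real of_real_1 of_real_diff of_real_divide)
  then show ?thesis
    using ln_cmod_one_minus_divide[OF assms False, of \<phi>] False
      ln_cmod_diff[OF False \<open>rcis r \<phi> \<noteq> w\<close>] ln_cmod_diff[OF _ ne]
    by (simp add: pot_kernel_def ray_gap_def)
qed

lemma ray_gap_nonneg:
  assumes "\<kappa> w \<le> 1" "0 < r" "r \<noteq> cmod w"
  shows "0 \<le> ray_gap \<kappa> r w"
  using assms unfolding ray_gap_def by (auto intro!: log_gap_nonneg simp: field_simps)

text \<open>This domination makes the potential finite at almost every radius.\<close>

lemma abs_radial_kernel_le:
  assumes r: "0 < r" "r \<noteq> cmod w"
  shows "\<bar>pot_kernel (of_real r) (of_real (cmod w))\<bar>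
    \<le> ray_gap (\<lambda>_. -1) r w + (\<bar>ln (r / 2)\<bar> + ln (1 + r))"
proof (cases "w = 0")
  case True
  have "ln r \<le> ln (1 + r)" "ln (r / 2) \<le> ln r" "0 \<le> ln (1 + r)" using r by auto
  then have "\<bar>ln r\<bar> \<le> \<bar>ln (r / 2)\<bar> + ln (1 + r)" by linarith
  with True r show ?thesis by (simp add: pot_kernel_def ray_gap_def)
next
  case False
  define s where "s = cmod w"
  define x where "x = r / s"
  have s: "0 < s" "r \<noteq> s" using False r by (auto simp: s_def)
  have x: "0 < x" "x \<noteq> 1" using s r by (auto simp: x_def field_simps)
  have "ln (1 - 2 * x * (-1) + x\<^sup>2) = ln ((1 + x)\<^sup>2)"
    by (simp add: power2_eq_square algebra_simps)
  also have "\<dots> = 2 * ln (1 + x)" using x by (simp only: ln_realpow)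
  finally have g: "ray_gap (\<lambda>_. -1) r w = ln (1 + x) - ln \<bar>1 - x\<bar>"
    using False by (simp add: ray_gap_def log_gap_def x_def s_def)
  have g0: "0 \<le> ray_gap (\<lambda>_. -1) r w" using r by (intro ray_gap_nonneg) auto
  have lx: "0 \<le> ln (1 + x)" "0 \<le> ln (1 + r)" using x r by auto
  show ?thesis
  proof (cases "s \<le> 1")
    case True
    have k: "pot_kernel (of_real r) (of_real (cmod w)) = ln \<bar>r - s\<bar>"
      using True unfolding pot_kernel_def s_def
      by (simp flip: of_real_diff)
    have "ln \<bar>r - s\<bar> \<le> ln (1 + r)"
      using s r True by (intro ln_mono) auto
    \<comment> \<open>If s <= r / 2, then |r - s| >= r / 2. Otherwise ln s >= ln (r / 2), and the
      gap ln (1 + x) - ln |1 - x| absorbs the singularity of ln |1 - x|.\<close>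
    moreover have "- (ray_gap (\<lambda>_. -1) r w + \<bar>ln (r / 2)\<bar>) \<le> ln \<bar>r - s\<bar>"
    proof (cases "s \<le> r / 2")
      case True
      then have "ln (r / 2) \<le> ln \<bar>r - s\<bar>" using r s by (intro ln_mono) auto
      then show ?thesis using g0 by linarith
    next
      case False
      then have "ln (r / 2) \<le> ln s" using r by (intro ln_mono) auto
      moreover have "\<bar>r - s\<bar> = s * \<bar>1 - x\<bar>"
        using s unfolding x_def by (simp add: abs_mult_pos' right_diff_distrib abs_minus_commute)
      then have "ln \<bar>r - s\<bar> = ln s + ln \<bar>1 - x\<bar>" using s x by (simp add: ln_mult)
      ultimately show ?thesis using g lx by linarith
    qed
    ultimately show ?thesis unfolding k using g0 lx by linarith
  next
    case False
    have "cmod (1 - complex_of_real r / complex_of_real s) = \<bar>1 - x\<bar>"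
      unfolding x_def by (metis norm_of_real of_real_1 of_real_diff of_real_divide)
    then have k: "pot_kernel (of_real r) (of_real (cmod w)) = ln \<bar>1 - x\<bar>"
      using False unfolding pot_kernel_def s_def[symmetric] by simp
    have "x \<le> r" using False s r unfolding x_def by (simp add: field_simps)
    then have "ln \<bar>1 - x\<bar> \<le> ln (1 + r)" using x r by (intro ln_mono) auto
    then show ?thesis unfolding k using g g0 lx by linarith
  qed
qed

section \<open>From the extended-valued potential to a Bochner integral\<close>

text \<open>\<open>e2ennreal\<close> truncates as \<open>ennreal\<close> does, so the two integrals
  are those of the positive and negative parts of h. Integrability makes both finite, which excludes
  infinity minus infinity.\<close>

lemma ext_integral_eq_set_integral:
  assumes [measurable]: "A \<in> sets M" and int: "set_integrable M A h"
    and eq: "AE x in M. x \<in> A \<longrightarrow> f x = ereal (h x)"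
  shows "ext_integral M A f = ereal (LINT x:A|M. h x)"
proof -
  define k where "k x = indicator A x * h x" for x
  have k: "integrable M k" using int by (simp add: set_integrable_def k_def[abs_def])
  have 1: "(\<integral>\<^sup>+x\<in>A. e2ennreal (f x) \<partial>M) = (\<integral>\<^sup>+x. ennreal (k x) \<partial>M)"
    by (rule nn_integral_cong_AE, use eq in eventually_elim)
      (auto simp: k_def split: split_indicator)
  have 2: "(\<integral>\<^sup>+x\<in>A. e2ennreal (- f x) \<partial>M) = (\<integral>\<^sup>+x. ennreal (- k x) \<partial>M)"
    by (rule nn_integral_cong_AE, use eq in eventually_elim)
      (auto simp: k_def split: split_indicator)
  have fin: "enn2ereal y = ereal (enn2real y)" if "y \<noteq> \<infinity>" for y
    using that by (cases y) auto
  have "(LINT x:A|M. h x) = enn2real (\<integral>\<^sup>+x. ennreal (k x) \<partial>M) - enn2real (\<integral>\<^sup>+x. ennreal (- k x) \<partial>M)"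
    using real_lebesgue_integral_def[OF k] by (simp add: set_lebesgue_integral_def k_def[abs_def])
  moreover have "(\<integral>\<^sup>+x. ennreal (k x) \<partial>M) \<noteq> \<infinity>" "(\<integral>\<^sup>+x. ennreal (- k x) \<partial>M) \<noteq> \<infinity>"
    using k by (auto simp: real_integrable_def)
  ultimately show ?thesis
    unfolding ext_integral_def 1 2 by (simp add: fin)
qed

text \<open>\<open>log_ext\<close> and ln differ only at 0, that is at w = z, and the two regions of
  integration partition the plane.\<close>

lemma potential_eq_integral:
  assumes sets: "sets M = sets borel" and int: "integrable M (pot_kernel z)" and ne: "AE w in M. w \<noteq> z"
  shows "potential M z = ereal (\<integral>w. pot_kernel z w \<partial>M)"
proof -
  note [measurable_cong] = sets
  let ?A = "{w. cmod w \<le> 1}" and ?B = "{w. 1 < cmod w}"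
  have m [measurable]: "?A \<in> sets M" "?B \<in> sets M" by (simp_all add: sets)
  have iA: "set_integrable M ?A (pot_kernel z)" and iB: "set_integrable M ?B (pot_kernel z)"
    using int m unfolding set_integrable_def by (blast intro: integrable_mult_indicator)+
  have A: "ext_integral M ?A (\<lambda>w. log_ext (cmod (z - w))) = ereal (LINT w:?A|M. pot_kernel z w)"
    using ne by (intro ext_integral_eq_set_integral m iA)
      (auto elim!: eventually_mono simp: log_ext_def pot_kernel_def)
  have B: "ext_integral M ?B (\<lambda>w. log_ext (cmod (1 - z / w))) = ereal (LINT w:?B|M. pot_kernel z w)"
    using ne by (intro ext_integral_eq_set_integral m iB)
      (auto elim!: eventually_mono simp: log_ext_def pot_kernel_def)
  have "(LINT w:?A \<union> ?B|M. pot_kernel z w) = (LINT w:?A|M. pot_kernel z w) + (LINT w:?B|M. pot_kernel z w)"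
    by (rule set_integral_Un[OF _ iA iB]) auto
  moreover have "?A \<union> ?B = UNIV" by auto
  moreover have "(LINT w:UNIV|M. pot_kernel z w) = (\<integral>w. pot_kernel z w \<partial>M)"
    by (simp add: set_lebesgue_integral_def)
  ultimately show ?thesis
    unfolding potential_def A B by simp
qed

section \<open>Integration over the measure and over almost every radius\<close>

locale borel_prob_complex = prob_space M for M :: "complex measure" +
  assumes sets_eq_borel [measurable_cong, simp]: "sets M = sets borel"

sublocale borel_prob_complex \<subseteq> lborel_M: pair_sigma_finite lborel M ..

context borel_prob_complex
begin

lemma space_eq_UNIV [simp]: "space M = UNIV"
  using sets_eq_imp_space_eq[OF sets_eq_borel] by simp

lemma measurable_gap [measurable]:
  assumes [measurable]: "\<kappa> \<in> borel_measurable borel"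
  shows "(\<lambda>(r, w). ray_gap \<kappa> r w) \<in> borel_measurable (lborel \<Otimes>\<^sub>M M)"
    and "ray_gap \<kappa> r \<in> borel_measurable M"
proof -
  show "(\<lambda>(r, w). ray_gap \<kappa> r w) \<in> borel_measurable (lborel \<Otimes>\<^sub>M M)"
    unfolding ray_gap_def log_gap_def by measurable
  show "ray_gap \<kappa> r \<in> borel_measurable M"
    unfolding ray_gap_def[abs_def] log_gap_def by measurable
qed

lemma measurable_pot_kernel [measurable]: "pot_kernel z \<in> borel_measurable M"
  unfolding pot_kernel_def[abs_def] by measurable

text \<open>Measurability comes from writing the weight as a parameter integral, with s = 1, so that
  \<open>arccos\<close> is never handled directly.\<close>

lemma measurable_gap_weight:
  assumes [measurable]: "\<kappa> \<in> borel_measurable borel" and b: "\<And>w. -1 \<le> \<kappa> w \<and> \<kappa> w \<le> 1"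
  shows "(\<lambda>w. gap_weight (\<kappa> w)) \<in> borel_measurable M"
proof -
  have "(\<lambda>w. enn2real (\<integral>\<^sup>+r. ennreal (log_gap (r / 1) (\<kappa> w) / r) * indicator {0<..} r \<partial>lborel)) \<in> borel_measurable M"
    unfolding log_gap_def by measurable
  then show ?thesis
    using b by (subst (asm) nn_integral_log_gap) (auto simp: gap_weight_bounds)
qed

text \<open>The indicator removes w = 0, where \<open>dir_cos\<close> has the junk value 0, whose
  weight is positive although the gap is 0.\<close>

definition mean_weight :: "(complex \<Rightarrow> real) \<Rightarrow> real" where
  "mean_weight \<kappa> = (\<integral>w. indicator (- {0}) w * gap_weight (\<kappa> w) \<partial>M)"

lemma integrable_gap_weight:
  assumes [measurable]: "\<kappa> \<in> borel_measurable borel" and b: "\<And>w. -1 \<le> \<kappa> w \<and> \<kappa> w \<le> 1"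
  shows "integrable M (\<lambda>w. indicator (- {0}) w * gap_weight (\<kappa> w))"
proof (rule integrable_const_bound[where B = "pi\<^sup>2 / 2"])
  note [measurable] = measurable_gap_weight[OF assms]
  show "(\<lambda>w. indicator (- {0}) w * gap_weight (\<kappa> w)) \<in> borel_measurable M"
    by measurable
  show "AE w in M. norm (indicator (- {0}) w * gap_weight (\<kappa> w)) \<le> pi\<^sup>2 / 2"
  proof (rule AE_I2)
    fix w
    show "norm (indicator (- {0}) w * gap_weight (\<kappa> w)) \<le> pi\<^sup>2 / 2"
      using gap_weight_bounds[of "\<kappa> w"] b[of w] by (auto split: split_indicator)
  qed
qed

text \<open>Tonelli: for nonzero w the inner radial integral is the weight, whatever |w| is.\<close>

lemma nn_integral_gap:
  assumes [measurable]: "\<kappa> \<in> borel_measurable borel" and b: "\<And>w. -1 \<le> \<kappa> w \<and> \<kappa> w \<le> 1"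
  shows "(\<integral>\<^sup>+r. (\<integral>\<^sup>+w. ennreal (ray_gap \<kappa> r w / r) * indicator {0<..} r \<partial>M) \<partial>lborel)
    = ennreal (mean_weight \<kappa>)"
proof -
  have "(\<integral>\<^sup>+r. (\<integral>\<^sup>+w. ennreal (ray_gap \<kappa> r w / r) * indicator {0<..} r \<partial>M) \<partial>lborel)
      = (\<integral>\<^sup>+w. (\<integral>\<^sup>+r. ennreal (ray_gap \<kappa> r w / r) * indicator {0<..} r \<partial>lborel) \<partial>M)"
    by (rule lborel_M.Fubini'[symmetric]) measurable
  also have "\<dots> = (\<integral>\<^sup>+w. ennreal (indicator (- {0}) w * gap_weight (\<kappa> w)) \<partial>M)"
    using b by (intro nn_integral_cong)
      (auto simp: ray_gap_def nn_integral_log_gap split: split_indicator)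
  also have "\<dots> = ennreal (mean_weight \<kappa>)"
    unfolding mean_weight_def using integrable_gap_weight[OF assms] b
    by (intro nn_integral_eq_integral) (auto simp: gap_weight_bounds)
  finally show ?thesis .
qed

text \<open>Each w excludes a single radius; exchanging the two quantifiers shows that almost every
  circle around 0 is null.\<close>

lemma AE_radius_ne_cmod: "AE r in lborel. AE w in M. r \<noteq> cmod w"
proof (subst lborel_M.AE_commute)
  show "{x \<in> space (lborel \<Otimes>\<^sub>M M). fst x \<noteq> cmod (snd x)} \<in> sets (lborel \<Otimes>\<^sub>M M)"
    by measurable
qed (auto intro: AE_lborel_singleton)

text \<open>A finite double integral has a finite inner integral at almost every radius.\<close>

lemma AE_integrable_gap:
  assumes [measurable]: "\<kappa> \<in> borel_measurable borel" and b: "\<And>w. -1 \<le> \<kappa> w \<and> \<kappa> w \<le> 1"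
  shows "AE r in lborel. 0 < r \<longrightarrow> integrable M (ray_gap \<kappa> r)"
proof -
  have "AE r in lborel. (\<integral>\<^sup>+w. ennreal (ray_gap \<kappa> r w / r) * indicator {0<..} r \<partial>M) \<noteq> \<infinity>"
    by (rule nn_integral_noteq_infinite) (use nn_integral_gap[OF assms] in auto)
  then show ?thesis
    using AE_radius_ne_cmod
  proof eventually_elim
    case (elim r)
    show ?case
    proof
      assume r: "0 < r"
      have "integrable M (\<lambda>w. ray_gap \<kappa> r w / r)"
      proof (rule integrableI_nonneg)
        show "AE w in M. 0 \<le> ray_gap \<kappa> r w / r"
          using elim(2) by eventually_elim (use r in \<open>auto intro!: divide_nonneg_pos ray_gap_nonneg simp: b\<close>)
        show "(\<integral>\<^sup>+w. ennreal (ray_gap \<kappa> r w / r) \<partial>M) < \<infinity>"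
          using elim(1) r by (simp add: top.not_eq_extremum)
      qed measurable
      then have "integrable M (\<lambda>w. r * (ray_gap \<kappa> r w / r))" by (rule integrable_mult_right)
      then show "integrable M (ray_gap \<kappa> r)" using r by simp
    qed
  qed
qed

text \<open>The kernel integral at r after M is moved along circles onto the positive axis. It does
  not depend on a direction and will cancel.\<close>

definition radial_mean :: "real \<Rightarrow> real" where
  "radial_mean r = (\<integral>w. pot_kernel (of_real r) (of_real (cmod w)) \<partial>M)"

lemma AE_potential_rcis:
  "AE r in lborel. 0 < r \<longrightarrow>
     potential M (rcis r \<phi>) = ereal (radial_mean r + (\<integral>w. ray_gap (dir_cos \<phi>) r w \<partial>M))"
proof -
  have "AE r in lborel. 0 < r \<longrightarrow> integrable M (ray_gap (dir_cos \<phi>) r)"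
    by (rule AE_integrable_gap) (auto simp: dir_cos_bounds)
  \<comment> \<open>The gap to the opposite direction dominates the radial kernel up to a constant
    depending on r, by \<open>abs_radial_kernel_le\<close>.\<close>
  moreover have "AE r in lborel. 0 < r \<longrightarrow> integrable M (ray_gap (\<lambda>_. -1) r)"
    by (rule AE_integrable_gap) auto
  ultimately show ?thesis
    using AE_radius_ne_cmod
  proof eventually_elim
    case (elim r)
    show ?case
    proof
      assume r: "0 < r"
      let ?B = "\<lambda>w. pot_kernel (of_real r) (complex_of_real (cmod w))"
      have iG: "integrable M (ray_gap (dir_cos \<phi>) r)" using elim r by simp
      have iB: "integrable M ?B"
      proof (rule Bochner_Integration.integrable_bound)
        show "integrable M (\<lambda>w. ray_gap (\<lambda>_. -1) r w + (\<bar>ln (r / 2)\<bar> + ln (1 + r)))"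
          using elim r by simp
        show "?B \<in> borel_measurable M"
          unfolding pot_kernel_def by measurable
        show "AE w in M. norm (?B w) \<le> norm (ray_gap (\<lambda>_. -1) r w + (\<bar>ln (r / 2)\<bar> + ln (1 + r)))"
          using elim(3)
        proof eventually_elim
          case (elim w)
          then show ?case using abs_radial_kernel_le[OF r elim] by simp
        qed
      qed
      have eq: "AE w in M. pot_kernel (rcis r \<phi>) w = ?B w + ray_gap (dir_cos \<phi>) r w"
        using elim(3) by eventually_elim (use r in \<open>auto intro: pot_kernel_rcis\<close>)
      have "integrable M (pot_kernel (rcis r \<phi>))"
        by (subst integrable_cong_AE[OF _ _ eq]) (use iB iG in auto)
      moreover have "AE w in M. w \<noteq> rcis r \<phi>"
        using elim(3) by eventually_elim (use r in auto)
      moreover have "(\<integral>w. pot_kernel (rcis r \<phi>) w \<partial>M) = radial_mean r + (\<integral>w. ray_gap (dir_cos \<phi>) r w \<partial>M)"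
        unfolding radial_mean_def using iB iG
        by (subst integral_cong_AE[OF _ _ eq]) auto
      ultimately show "potential M (rcis r \<phi>) = ereal (radial_mean r + (\<integral>w. ray_gap (dir_cos \<phi>) r w \<partial>M))"
        by (simp add: potential_eq_integral)
    qed
  qed
qed

text \<open>The radial mean is a real number common to both rays, so it cancels from the inequality
  between the potentials and leaves one between the gap integrals.\<close>

lemma AE_nn_integral_gap_le:
  assumes "\<And>z. potential M z \<le> potential M (complex_of_real (cmod z))"
  shows "AE r in lborel. (\<integral>\<^sup>+w. ennreal (ray_gap (dir_cos \<phi>) r w / r) * indicator {0<..} r \<partial>M)
    \<le> (\<integral>\<^sup>+w. ennreal (ray_gap (dir_cos 0) r w / r) * indicator {0<..} r \<partial>M)"
proof -
  have i: "AE r in lborel. 0 < r \<longrightarrow> integrable M (ray_gap (dir_cos \<psi>) r)" for \<psi>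
    by (rule AE_integrable_gap) (auto simp: dir_cos_bounds)
  show ?thesis
    using i[of \<phi>] i[of 0] AE_potential_rcis[of \<phi>] AE_potential_rcis[of 0] AE_radius_ne_cmod
  proof eventually_elim
    case (elim r)
    show ?case
    proof (cases "0 < r")
      case r: True
      have e: "(\<integral>\<^sup>+w. ennreal (ray_gap (dir_cos \<psi>) r w / r) \<partial>M) = ennreal ((\<integral>w. ray_gap (dir_cos \<psi>) r w \<partial>M) / r)"
        if "integrable M (ray_gap (dir_cos \<psi>) r)" for \<psi>
      proof -
        have "AE w in M. 0 \<le> ray_gap (dir_cos \<psi>) r w / r"
          using elim(5) by eventually_elim (use r in \<open>auto intro!: divide_nonneg_pos ray_gap_nonneg simp: dir_cos_bounds\<close>)
        then show ?thesis using that by (subst nn_integral_eq_integral) auto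
      qed
      have "potential M (rcis r \<phi>) \<le> potential M (rcis r 0)"
        using assms[of "rcis r \<phi>"] r by (simp add: rcis_def norm_mult)
      then have "(\<integral>w. ray_gap (dir_cos \<phi>) r w \<partial>M) \<le> (\<integral>w. ray_gap (dir_cos 0) r w \<partial>M)"
        using elim r by simp
      then show ?thesis
        using r elim by (simp add: e divide_right_mono ennreal_leI)
    qed simp
  qed
qed

lemma mean_weight_dir_cos_le:
  assumes "\<And>z. potential M z \<le> potential M (complex_of_real (cmod z))"
  shows "mean_weight (dir_cos \<phi>) \<le> mean_weight (dir_cos 0)"
proof -
  have "ennreal (mean_weight (dir_cos \<phi>)) \<le> ennreal (mean_weight (dir_cos 0))"
    using nn_integral_mono_AE[OF AE_nn_integral_gap_le[OF assms, of \<phi>]]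
    by (simp add: nn_integral_gap dir_cos_bounds)
  \<comment> \<open>Allows the inequality to be read back in the reals, as \<open>ennreal\<close>
    truncates negative numbers.\<close>
  moreover have "0 \<le> mean_weight (dir_cos 0)"
    unfolding mean_weight_def
    by (intro integral_nonneg_AE) (auto simp: gap_weight_bounds dir_cos_bounds)
  ultimately show ?thesis by (simp add: ennreal_le_iff)
qed

section \<open>Sector masses in terms of gap weights\<close>

text \<open>\<open>gap_weight_symmetrized\<close> expresses the excess of a over |Arg w| through gap
  weights, so measurability and integrability are inherited from these. The term a^2 contributes the
  mass off the origin.\<close>

lemma integrable_arg_excess:
  assumes "0 < a" "a \<le> pi"
  shows "integrable M (\<lambda>w. indicator (- {0}) w * max 0 (a - \<bar>Arg w\<bar>))" (is "integrable M ?f")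
    and "2 * pi * (\<integral>w. indicator (- {0}) w * max 0 (a - \<bar>Arg w\<bar>) \<partial>M)
      = mean_weight (dir_cos a) + mean_weight (dir_cos (- a)) - 2 * mean_weight (dir_cos 0)
        + a\<^sup>2 * measure M (- {0})"
proof -
  let ?g = "\<lambda>\<phi> w. indicator (- {0}) w * gap_weight (dir_cos \<phi> w)"
  have i: "integrable M (?g \<phi>)" for \<phi>
    by (rule integrable_gap_weight) (auto simp: dir_cos_bounds)
  have eq: "2 * pi * ?f w = ?g a w + ?g (- a) w - 2 * ?g 0 w + a\<^sup>2 * indicator (- {0}) w" for w
    using gap_weight_symmetrized[OF assms, of "Arg w"] Arg_bounded[of w]
    by (cases "w = 0") (auto simp: dir_cos_eq)
  have "integrable M (\<lambda>w. 2 * pi * ?f w)"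
    unfolding eq by (intro Bochner_Integration.integrable_add Bochner_Integration.integrable_diff
        integrable_mult_right i) (auto simp: less_top[symmetric])
  then show "integrable M ?f" by simp
  have "(\<integral>w. 2 * pi * ?f w \<partial>M)
      = mean_weight (dir_cos a) + mean_weight (dir_cos (- a)) - 2 * mean_weight (dir_cos 0)
        + a\<^sup>2 * measure M (- {0})"
    unfolding eq mean_weight_def using i by (simp add: less_top[symmetric])
  then show "2 * pi * (\<integral>w. ?f w \<partial>M)
      = mean_weight (dir_cos a) + mean_weight (dir_cos (- a)) - 2 * mean_weight (dir_cos 0)
        + a\<^sup>2 * measure M (- {0})"
    by simp
qed

text \<open>Layer cake: for nonzero w, the t in [0, a] with |Arg w| <= t form an interval of length
  max 0 (a - |Arg w|).\<close>

lemma set_integral_sector_mass: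
  assumes a: "0 < a" "a \<le> pi"
  shows "(LBINT t:{0..a}. sector_mass M t) = (\<integral>w. indicator (- {0}) w * max 0 (a - \<bar>Arg w\<bar>) \<partial>M)"
proof -
  \<comment> \<open>cos decreases on [0, pi], so the sectors can be described by the measurable
    function \<open>dir_cos 0\<close>.\<close>
  have arg: "\<bar>Arg w\<bar> \<le> t \<longleftrightarrow> cos t \<le> dir_cos 0 w" if "0 \<le> t" "t \<le> a" "w \<noteq> 0" for t w
  proof -
    have "cos t \<le> cos \<bar>Arg w\<bar> \<longleftrightarrow> \<bar>Arg w\<bar> \<le> t"
      using that a Arg_bounded[of w] by (intro cos_mono_le_eq) auto
    then show ?thesis using that by (simp add: dir_cos_eq)
  qed
  define S where "S t = {w. w \<noteq> 0 \<and> cos t \<le> dir_cos 0 w}" for t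
  have S [measurable]: "S t \<in> sets M" for t
    unfolding S_def by measurable
  have [measurable]: "(\<lambda>(t, w). indicator (S t) w :: ennreal) \<in> borel_measurable (lborel \<Otimes>\<^sub>M M)"
    unfolding S_def indicator_def by measurable
  have sm: "sector_mass M t = measure M (S t)" if "t \<in> {0..a}" for t
    unfolding sector_mass_def S_def using that arg by (intro arg_cong[where f = "measure M"]) auto
  have em: "(\<lambda>t. emeasure M (S t)) \<in> borel_measurable lborel"
  proof -
    have "(\<lambda>t. \<integral>\<^sup>+w. indicator (S t) w \<partial>M) \<in> borel_measurable lborel" by measurable
    then show ?thesis by (simp only: nn_integral_indicator S)
  qed
  then have [measurable]: "(\<lambda>t. measure M (S t)) \<in> borel_measurable borel"
    unfolding measure_def by measurable
  have "(LBINT t:{0..a}. sector_mass M t) = (LBINT t:{0..a}. measure M (S t))"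
    by (rule set_lebesgue_integral_cong) (auto simp: sm)
  also have "\<dots> = enn2real (\<integral>\<^sup>+t. ennreal (indicator {0..a} t * measure M (S t)) \<partial>lborel)"
    unfolding set_lebesgue_integral_def real_scaleR_def
    by (rule integral_eq_nn_integral) auto
  also have "(\<integral>\<^sup>+t. ennreal (indicator {0..a} t * measure M (S t)) \<partial>lborel)
      = (\<integral>\<^sup>+t. (\<integral>\<^sup>+w. indicator (S t) w * indicator {0..a} t \<partial>M) \<partial>lborel)"
    by (intro nn_integral_cong) (auto simp: nn_integral_indicator[OF S] emeasure_eq_measure split: split_indicator)
  also have "\<dots> = (\<integral>\<^sup>+w. (\<integral>\<^sup>+t. indicator (S t) w * indicator {0..a} t \<partial>lborel) \<partial>M)"
    by (rule lborel_M.Fubini'[symmetric]) measurable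
  also have "\<dots> = (\<integral>\<^sup>+w. ennreal (indicator (- {0}) w * max 0 (a - \<bar>Arg w\<bar>)) \<partial>M)"
  proof (rule nn_integral_cong)
    fix w
    show "(\<integral>\<^sup>+t. indicator (S t) w * indicator {0..a} t \<partial>lborel)
        = ennreal (indicator (- {0}) w * max 0 (a - \<bar>Arg w\<bar>))"
    proof (cases "w = 0")
      case False
      have "(\<integral>\<^sup>+t. indicator (S t) w * indicator {0..a} t \<partial>lborel)
          = (\<integral>\<^sup>+t. indicator {\<bar>Arg w\<bar>..a} t \<partial>lborel)"
        using False arg[of _ w] by (intro nn_integral_cong) (auto simp: S_def split: split_indicator)
      then show ?thesis using False by (auto simp: max_def ennreal_neg)
    qed (simp add: S_def)
  qed
  also have "enn2real \<dots> = (\<integral>w. indicator (- {0}) w * max 0 (a - \<bar>Arg w\<bar>) \<partial>M)"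
    using integrable_arg_excess(1)[OF a]
    by (intro integral_eq_nn_integral[symmetric]) auto
  finally show ?thesis .
qed

end

theorem theorem1:
  fixes M :: "complex measure"
  assumes "prob_space M"
    and "sets M = sets borel"
    and "conj_symmetric M"
    and "\<forall>z. potential M z \<le> potential M (complex_of_real (cmod z))"
  shows "\<forall>a::real. 0 < a \<and> a \<le> pi \<longrightarrow>
           1 / a * (LBINT t:{0..a}. sector_mass M t) \<le> a / (2 * pi)"
proof (intro allI impI)
  fix a :: real
  assume a: "0 < a \<and> a \<le> pi"
  interpret borel_prob_complex M
    using assms(1,2) by (simp add: borel_prob_complex_def borel_prob_complex_axioms_def)
  \<comment> \<open>The origin lies in no sector, so only the mass off 0 enters; it is at most
    1.\<close>
  have "a\<^sup>2 * measure M (- {0}) \<le> a\<^sup>2 * 1"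
    by (intro mult_left_mono) auto
  moreover have "mean_weight (dir_cos \<phi>) \<le> mean_weight (dir_cos 0)" for \<phi>
    using assms(4) by (intro mean_weight_dir_cos_le) auto
  \<comment> \<open>At a and at -a the mean weight is at most the one at 0, so the mean weights in
    the identity for the excess contribute at most 0.\<close>
  from this[of a] this[of "- a"]
  have "2 * pi * (LBINT t:{0..a}. sector_mass M t) \<le> a\<^sup>2 * measure M (- {0})"
    using a integrable_arg_excess(2)[of a] set_integral_sector_mass[of a] by simp
  ultimately have "2 * pi * (LBINT t:{0..a}. sector_mass M t) \<le> a\<^sup>2"
    by linarith
  then show "1 / a * (LBINT t:{0..a}. sector_mass M t) \<le> a / (2 * pi)"
    using a by (simp add: field_simps power2_eq_square)
qed

end
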